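(* Let $X$ be a real Hausdorff locally convex topological vector space, let $F\subset X$ be a convex set with $0\in\operatorname{int}(F)$, and let $\Omega$ be a nonempty convex subset of $X$. Let $\bar x\in\mathrm{cl}_F(\Omega)$. Then $$\partial\mathcal{T}^F_{\Omega}(\bar x)=N\big(\bar x;\mathrm{cl}_F(\Omega)\big)\cap C^*,\qquad\text{where } C^*:=\{x^*\in X^*\mid \sigma_F(-x^* )\le 1\}.$$
   Context: $X^*$ is the topological dual of $X$, with pairing $\langle x^*,x\rangle=x^*(x)$. The minimal time function with target $\Omega$ and dynamics $F$ is $\mathcal{T}_{\Omega}^F(x):=\inf\{t>0\mid (x+tF)\cap\Omega\neq\emptyset\}$, $x\in X$ (it is real-valued when $0\in\operatorname{int}(F)$ and $\Omega\ne\emptyset$). The $F$-closure of $\Omega$ is $\mathrm{cl}_F(\Omega):=\bigcap_{\varepsilon>0}(\Omega-\varepsilon F)$. The support function of $F$ is $\sigma_F(x^* ):=\sup\{\langle x^*,f\rangle\mid f\in F\}\in(-\infty,\infty]$. For a convex set $A\subset X$ and $\bar x\in A$, the normal cone is $N(\bar x;A):=\{x^*\in X^*\mid \langle x^*,x-\bar x\rangle\le 0\text{ for all }x\in A\}$. For a convex function $\varphi:X\to(-\infty,\infty]$ and $\bar x$ with $\varphi(\bar x)<\infty$, $\partial\varphi(\bar x):=\{x^*\in X^*\mid\langle x^*,x-\bar x\rangle\le\varphi(x)-\varphi(\bar x)\text{ for all }x\in X\}$. *)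

theory Defs
  imports "HOL-Analysis.Analysis"
begin

class topological_real_vector = real_vector + topological_ab_group_add +
  assumes tendsto_scaleR_Pair:
    "LIM p (nhds c \<times>\<^sub>F nhds a). fst p *\<^sub>R snd p :> nhds (c *\<^sub>R a)"

text \<open>Hausdorff separation is not included; it is the separate class \<^class>\<open>t2_space\<close>.\<close>

text \<open>The axiom is a local base at \<open>0\<close> of convex open sets, see \<open>locally_convex_0\<close> below; the
  constant \<^const>\<open>convex\<close> is not available inside a class specification, so it is unfolded.\<close>

class locally_convex_space = topological_real_vector +
  assumes locally_convex_0_unfolded:
    "open U \<Longrightarrow> 0 \<in> U \<Longrightarrow> \<exists>V. open V \<and> 0 \<in> V \<and> V \<subseteq> U \<and>
       (\<forall>x\<in>V. \<forall>y\<in>V. \<forall>u\<ge>0. \<forall>v\<ge>0. u + v = 1 \<longrightarrow> u *\<^sub>R x + v *\<^sub>R y \<in> V)"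

lemma locally_convex_0:
  fixes U :: "'a::locally_convex_space set"
  assumes "open U" "0 \<in> U"
  shows "\<exists>V. open V \<and> 0 \<in> V \<and> V \<subseteq> U \<and> convex V"
  using locally_convex_0_unfolded[OF assms] by (simp add: convex_def)

instance real_normed_vector < locally_convex_space
proof
  fix c :: real and a :: 'a
  show "LIM p (nhds c \<times>\<^sub>F nhds a). fst p *\<^sub>R snd p :> nhds (c *\<^sub>R a)"
    by (intro tendsto_scaleR filterlim_fst filterlim_snd)
next
  fix U :: "'a set"
  assume "open U" "0 \<in> U"
  then obtain e where "e > 0" "ball 0 e \<subseteq> U"
    by (auto simp: open_contains_ball)
  then show "\<exists>V. open V \<and> 0 \<in> V \<and> V \<subseteq> U \<and>
      (\<forall>x\<in>V. \<forall>y\<in>V. \<forall>u\<ge>0. \<forall>v\<ge>0. u + v = 1 \<longrightarrow> u *\<^sub>R x + v *\<^sub>R y \<in> V)"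
    using convex_ball[of "0::'a" e] unfolding convex_def
    by (intro exI[of _ "ball 0 e"]) simp
qed

definition topological_dual :: "('a::topological_real_vector \<Rightarrow> real) set" where
  "topological_dual = {xs. linear xs \<and> continuous_on UNIV xs}"

text \<open>The infimum is taken in \<^typ>\<open>ereal\<close>, so it is \<open>\<infinity>\<close> when no \<open>t > 0\<close> is admissible.\<close>

definition minimal_time :: "'a::real_vector set \<Rightarrow> 'a set \<Rightarrow> 'a \<Rightarrow> ereal" where
  "minimal_time F \<Omega> x =
     Inf {ereal t | t. t > 0 \<and> (\<lambda>f. x + t *\<^sub>R f) ` F \<inter> \<Omega> \<noteq> {}}"

definition F_closure :: "'a::real_vector set \<Rightarrow> 'a set \<Rightarrow> 'a set" where
  "F_closure F \<Omega> = (\<Inter>\<epsilon>\<in>{0<..}. {w - \<epsilon> *\<^sub>R f | w f. w \<in> \<Omega> \<and> f \<in> F})"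

definition support_fun :: "'a set \<Rightarrow> ('a \<Rightarrow> real) \<Rightarrow> ereal" where
  "support_fun F xs = (SUP f\<in>F. ereal (xs f))"

text \<open>Meant for convex \<open>A\<close> and \<open>xb \<in> A\<close>.\<close>

definition normal_cone :: "'a::topological_real_vector \<Rightarrow> 'a set \<Rightarrow> ('a \<Rightarrow> real) set" where
  "normal_cone xb A = {xs \<in> topological_dual. \<forall>x\<in>A. xs (x - xb) \<le> 0}"

text \<open>Meant for convex \<open>\<phi>\<close> with values in \<open>(-\<infinity>, \<infinity>]\<close> and \<open>\<phi> xb < \<infinity>\<close>, so that the
  \<^typ>\<open>ereal\<close> difference is never of the form \<open>\<infinity> - \<infinity>\<close>.\<close>

definition subdifferential ::
    "('a::topological_real_vector \<Rightarrow> ereal) \<Rightarrow> 'a \<Rightarrow> ('a \<Rightarrow> real) set" where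
  "subdifferential \<phi> xb =
     {xs \<in> topological_dual. \<forall>x. ereal (xs (x - xb)) \<le> \<phi> x - \<phi> xb}"

definition C_star :: "'a::topological_real_vector set \<Rightarrow> ('a \<Rightarrow> real) set" where
  "C_star F = {xs \<in> topological_dual. support_fun F (\<lambda>x. - xs x) \<le> 1}"

end

theory Submission
  imports Defs
begin

text \<open>For \<open>0 \<in> F\<close> the minimal time function \<open>T\<close> vanishes on the \<open>F\<close>-closure of \<open>\<Omega>\<close>, so a
  subgradient \<open>xs\<close> at \<open>xb\<close> satisfies \<open>xs (x - xb) \<le> T x\<close>. Points \<open>x\<close> of the \<open>F\<close>-closure give the
  normal cone condition, and \<open>x = xb - f\<close> with \<open>f \<in> F\<close>, where \<open>T x \<le> 1\<close> by convexity of \<open>F\<close>, gives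
  \<open>- xs f \<le> 1\<close>. Conversely, if \<open>x + t f \<in> \<Omega>\<close>, then the normal cone condition at \<open>x + t f\<close> yields
  \<open>xs (x - xb) \<le> - t xs f \<le> t\<close>; now take the infimum over \<open>t\<close>.\<close>

lemma minimal_time_le:
  assumes "t > 0" "f \<in> F" "x + t *\<^sub>R f \<in> \<Omega>"
  shows "minimal_time F \<Omega> x \<le> ereal t"
  unfolding minimal_time_def using assms by (intro Inf_lower) blast

lemma minimal_time_greatest:
  assumes "\<And>t f. t > 0 \<Longrightarrow> f \<in> F \<Longrightarrow> x + t *\<^sub>R f \<in> \<Omega> \<Longrightarrow> c \<le> ereal t"
  shows "c \<le> minimal_time F \<Omega> x"
  unfolding minimal_time_def using assms by (intro Inf_greatest) blast

lemma minimal_time_nonneg: "0 \<le> minimal_time F \<Omega> x"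
  by (rule minimal_time_greatest) simp

text \<open>Solving \<open>x = w - \<epsilon> *\<^sub>R f\<close> for \<open>w\<close> turns
  membership into reachability: every positive time suffices to get from \<open>x\<close> into
  \<open>\<Omega>\<close>.\<close>

lemma F_closureE:
  assumes "x \<in> F_closure F \<Omega>" "\<epsilon> > 0"
  obtains f where "f \<in> F" "x + \<epsilon> *\<^sub>R f \<in> \<Omega>"
proof -
  obtain w f where "w \<in> \<Omega>" "f \<in> F" "x = w - \<epsilon> *\<^sub>R f"
    using assms unfolding F_closure_def by blast
  then show thesis
    using that[of f] by simp
qed

lemma subset_F_closure:
  assumes "0 \<in> F"
  shows "\<Omega> \<subseteq> F_closure F \<Omega>"
proof
  fix w assume "w \<in> \<Omega>"
  moreover have "w = w - \<epsilon> *\<^sub>R 0" for \<epsilon> :: real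
    by simp
  ultimately show "w \<in> F_closure F \<Omega>"
    unfolding F_closure_def using assms by blast
qed

text \<open>Moving along \<open>f\<close> for time \<open>t\<close> leads back to \<open>x\<close>,
  and from there \<open>\<Omega>\<close> is reached within any extra time \<open>e\<close>.
  Convexity merges the two legs into one direction of \<open>F\<close>.\<close>

lemma minimal_time_F_closure_diff_le:
  assumes "convex F" "x \<in> F_closure F \<Omega>" "f \<in> F" "t \<ge> 0"
  shows "minimal_time F \<Omega> (x - t *\<^sub>R f) \<le> ereal t"
proof (rule ereal_le_epsilon2)
  fix e :: real assume e: "e > 0"
  obtain g where g: "g \<in> F" "x + e *\<^sub>R g \<in> \<Omega>"
    using F_closureE[OF assms(2) e] .
  \<comment> \<open>The average velocity of the two legs, weighted by their durations.\<close>
  define h where "h = (t / (t + e)) *\<^sub>R f + (e / (t + e)) *\<^sub>R g"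
  have "h \<in> F"
    unfolding h_def using assms e g
    by (intro convexD) (auto simp: add_divide_distrib[symmetric])
  moreover have "(t + e) *\<^sub>R h = t *\<^sub>R f + e *\<^sub>R g"
    unfolding h_def using assms(4) e by (simp add: scaleR_add_right)
  then have "x - t *\<^sub>R f + (t + e) *\<^sub>R h \<in> \<Omega>"
    using g by simp
  ultimately show "minimal_time F \<Omega> (x - t *\<^sub>R f) \<le> ereal t + ereal e"
    using minimal_time_le[of "t + e" h F "x - t *\<^sub>R f" \<Omega>] assms(4) e by simp
qed

lemma minimal_time_F_closure_eq_0:
  assumes "convex F" "x \<in> F_closure F \<Omega>"
  shows "minimal_time F \<Omega> x = 0"
proof -
  \<comment> \<open>Any point of \<open>F\<close> serves, since it enters only with
    \<open>t = 0\<close>.\<close>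
  obtain f where "f \<in> F"
    using F_closureE[OF assms(2), of 1] by auto
  then show ?thesis
    using minimal_time_F_closure_diff_le[OF assms, of f 0] minimal_time_nonneg[of F \<Omega> x]
    by (simp add: antisym zero_ereal_def)
qed

lemma mem_C_star_iff:
  "xs \<in> C_star F \<longleftrightarrow> xs \<in> topological_dual \<and> (\<forall>f\<in>F. - xs f \<le> 1)"
  unfolding C_star_def support_fun_def by (simp add: SUP_le_iff)

theorem theorem4p2:
  fixes F \<Omega> :: "'a::{locally_convex_space, t2_space} set"
    and xb :: 'a
  assumes "convex F" and "0 \<in> interior F"
    and "convex \<Omega>" and "\<Omega> \<noteq> {}"
    and "xb \<in> F_closure F \<Omega>"
  shows "subdifferential (minimal_time F \<Omega>) xb
           = normal_cone xb (F_closure F \<Omega>) \<inter> C_star F"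
proof (intro set_eqI iffI)
  have T0: "minimal_time F \<Omega> x = 0" if "x \<in> F_closure F \<Omega>" for x
    using minimal_time_F_closure_eq_0[OF assms(1) that] .
  fix xs
  {
    assume xs: "xs \<in> subdifferential (minimal_time F \<Omega>) xb"
    \<comment> \<open>The subtracted value at \<open>xb\<close> is 0.\<close>
    then have dual: "xs \<in> topological_dual"
      and le: "ereal (xs (x - xb)) \<le> minimal_time F \<Omega> x" for x
      unfolding subdifferential_def using T0[OF assms(5)] by auto
    interpret linear xs
      using dual by (simp add: topological_dual_def)
    have "xs (x - xb) \<le> 0" if "x \<in> F_closure F \<Omega>" for x
      using le[of x] T0[OF that] by simp
    moreover have "- xs f \<le> 1" if "f \<in> F" for f
      \<comment> \<open>The factor 1 matches the bound at \<open>t = 1\<close>; the argument of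
        \<open>xs\<close> becomes \<open>- f\<close>.\<close>
      using order_trans[OF le[of "xb - 1 *\<^sub>R f"]
          minimal_time_F_closure_diff_le[OF assms(1,5) that, of 1]]
      by (simp add: neg)
    ultimately show "xs \<in> normal_cone xb (F_closure F \<Omega>) \<inter> C_star F"
      using dual by (simp add: normal_cone_def mem_C_star_iff)
  next
    assume "xs \<in> normal_cone xb (F_closure F \<Omega>) \<inter> C_star F"
    then have dual: "xs \<in> topological_dual"
      and normal: "\<And>x. x \<in> F_closure F \<Omega> \<Longrightarrow> xs (x - xb) \<le> 0"
      and polar: "\<And>f. f \<in> F \<Longrightarrow> - xs f \<le> 1"
      by (auto simp: normal_cone_def mem_C_star_iff)
    interpret linear xs
      using dual by (simp add: topological_dual_def)
    \<comment> \<open>The normal cone tests points of the closure, while trajectories end in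
      \<open>\<Omega>\<close>.\<close>
    have "\<Omega> \<subseteq> F_closure F \<Omega>"
      using subset_F_closure interior_subset assms(2) by blast
    have "ereal (xs (x - xb)) \<le> minimal_time F \<Omega> x" for x
    proof (rule minimal_time_greatest)
      fix t f assume t: "t > 0" and f: "f \<in> F" "x + t *\<^sub>R f \<in> \<Omega>"
      have "xs (x + t *\<^sub>R f - xb) \<le> 0"
        using normal f(2) \<open>\<Omega> \<subseteq> F_closure F \<Omega>\<close> by blast
      moreover have "t * (- xs f) \<le> t * 1"
        using t polar[OF f(1)] by (intro mult_left_mono) auto
      ultimately show "ereal (xs (x - xb)) \<le> ereal t"
        by (simp add: add diff scale)
    qed
    then show "xs \<in> subdifferential (minimal_time F \<Omega>) xb"
      unfolding subdifferential_def using dual T0[OF assms(5)] by simp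
  }
qed

end
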